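(* Let $f=(f_n)_{n\ge1}$ with $f_n:\{0,1\}^n\times\{0,1\}^n\to\{0,1\}$. If $f$ is log-space computable, then $GH(f_n)$ is polynomial in $n$, i.e. there is a polynomial $p$ with $GH(f_n)\le p(n)$ for all $n$.
   Context: $f$ is log-space computable if there are a deterministic Turing machine $M$ (with a read-only input tape and work tapes) and a constant $c$ such that on every input of length $N=2n$, consisting of $x$ followed by $y$, $M$ outputs $f_n(x,y)$ and visits at most $c\log N$ cells of its work tapes. Garden-hose game of size $s\in\mathbb{N}$: let $A=\{1^A,\dots,s^A\}$, $B=\{1^B,\dots,s^B\}$, $A_\circ=A\cup\{0\}$, and $E=\{\{i^A,i^B\}:1\le i\le s\}$ (the pipes). A game $G$ is given by functions $E_{A_\circ},E_B$ on $\{0,1\}^n$, where $E_{A_\circ}(x)$ is a set of edges (no self-loops) on $A_\circ$ and $E_B(y)$ is a set of edges (no self-loops) on $B$, such that the graphs $(A_\circ,E_{A_\circ}(x))$ and $(B,E_B(y))$ have maximum degree at most $1$. Put $G(x,y)=(A_\circ\cup B,\,E\cup E_{A_\circ}(x)\cup E_B(y))$. There is a unique maximal path $\pi(x,y)$ in $G(x,y)$ starting at $0$ (it consists of $0$ alone if $0$ has degree $0$). $G$ computes a function $h:\{0,1\}^n\times\{0,1\}^n\to\{0,1\}$ if for all $x,y$ the endpoint of $\pi(x,y)$ lies in $A_\circ$ when $h(x,y)=0$ and in $B$ when $h(x,y)=1$. $GH(h)$ is the smallest size $s$ of a game computing $h$. *)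

theory Defs
  imports Complex_Main "HOL-Computational_Algebra.Polynomial"
begin

section \<open>Deterministic Turing machines with a read-only input tape\<close>

text \<open>
  The input word \<open>w\<close> occupies the cells \<open>1, \<dots>, length w\<close> of the input tape, between the
  end markers in the cells \<open>0\<close> and \<open>length w + 1\<close>. The input head cannot leave this range:
  otherwise its position would be an additional counter whose space is not accounted for.
  Work tapes are two-way infinite. States and work symbols are named by natural numbers, so that
  one can quantify over all machines.
\<close>

datatype input_symbol = Left_End | Bit bool | Right_End

datatype move = Go_Left | Stay | Go_Right

text \<open>
  The second argument of the transition function is the scanned input symbol, the third lists the
  symbols scanned on the work tapes; its result consists of the new state, the move of the input
  head and, for each work tape, the symbol to be written and the move of the head. The bit that the
  machine outputs is determined by the state in which it halts.
\<close>

record tm =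
  tapes :: nat
  states :: "nat set"
  symbols :: "nat set"
  blank :: nat
  start :: nat
  halting :: "nat set"
  output_bit :: "nat \<Rightarrow> bool"
  delta :: "nat \<Rightarrow> input_symbol \<Rightarrow> nat list \<Rightarrow> nat \<times> move \<times> (nat \<times> move) list"

definition turing_machine :: "tm \<Rightarrow> bool" where
  "turing_machine M \<longleftrightarrow>
     finite (states M) \<and> finite (symbols M) \<and>
     blank M \<in> symbols M \<and> start M \<in> states M \<and> halting M \<subseteq> states M \<and>
     (\<forall>q \<in> states M - halting M. \<forall>a bs. set bs \<subseteq> symbols M \<and> length bs = tapes M \<longrightarrow>
        (case delta M q a bs of (q', d, acts) \<Rightarrow>
           q' \<in> states M \<and> length acts = tapes M \<and> (\<forall>(b, e) \<in> set acts. b \<in> symbols M)))"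

text \<open>A work tape is given by its contents and the position of its head.\<close>

type_synonym work_tape = "(int \<Rightarrow> nat) \<times> int"

record config =
  state :: nat
  input_head :: nat
  work :: "work_tape list"

definition read_input :: "bool list \<Rightarrow> nat \<Rightarrow> input_symbol" where
  "read_input w i =
     (if i = 0 then Left_End else if i \<le> length w then Bit (w ! (i - 1)) else Right_End)"

fun move_input :: "bool list \<Rightarrow> move \<Rightarrow> nat \<Rightarrow> nat" where
  "move_input w Go_Left i = i - 1"
| "move_input w Stay i = i"
| "move_input w Go_Right i = min (i + 1) (length w + 1)"

fun move_work :: "move \<Rightarrow> int \<Rightarrow> int" where
  "move_work Go_Left p = p - 1"
| "move_work Stay p = p"
| "move_work Go_Right p = p + 1"

fun act :: "nat \<times> move \<Rightarrow> work_tape \<Rightarrow> work_tape" where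
  "act (b, e) (u, p) = (u(p := b), move_work e p)"

definition init_config :: "tm \<Rightarrow> config" where
  "init_config M =
     \<lparr>state = start M, input_head = 1, work = replicate (tapes M) (\<lambda>_. blank M, 0)\<rparr>"

definition step :: "tm \<Rightarrow> bool list \<Rightarrow> config \<Rightarrow> config" where
  "step M w C =
     (if state C \<in> halting M then C
      else case delta M (state C) (read_input w (input_head C)) (map (\<lambda>(u, p). u p) (work C)) of
        (q, d, acts) \<Rightarrow>
          \<lparr>state = q, input_head = move_input w d (input_head C), work = map2 act acts (work C)\<rparr>)"

definition run :: "tm \<Rightarrow> bool list \<Rightarrow> nat \<Rightarrow> config" where
  "run M w t = (step M w ^^ t) (init_config M)"

definition visited_cells :: "tm \<Rightarrow> bool list \<Rightarrow> nat \<Rightarrow> (nat \<times> int) set" where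
  "visited_cells M w T = (\<lambda>(j, t). (j, snd (work (run M w t) ! j))) ` ({..<tapes M} \<times> {..T})"

definition outputs_in_space :: "tm \<Rightarrow> bool list \<Rightarrow> bool \<Rightarrow> real \<Rightarrow> bool" where
  "outputs_in_space M w b m \<longleftrightarrow>
     (\<exists>T. state (run M w T) \<in> halting M \<and> output_bit M (state (run M w T)) = b \<and>
          real (card (visited_cells M w T)) \<le> m)"

text \<open>
  Elements of \<open>{0,1}^n\<close> are the Boolean lists of length \<open>n\<close>. The values of \<open>f n\<close> on lists of any
  other length are irrelevant.
\<close>

definition logspace_computable :: "(nat \<Rightarrow> bool list \<Rightarrow> bool list \<Rightarrow> bool) \<Rightarrow> bool" where
  "logspace_computable f \<longleftrightarrow>
     (\<exists>M c. turing_machine M \<and>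
        (\<forall>n\<ge>1. \<forall>x y. length x = n \<and> length y = n \<longrightarrow>
           outputs_in_space M (x @ y) (f n x y) (c * log 2 (real (2 * n)))))"


section \<open>Graphs and maximal paths\<close>

definition edges_on :: "'v set \<Rightarrow> 'v set set \<Rightarrow> bool" where
  "edges_on V E \<longleftrightarrow> (\<forall>e \<in> E. \<exists>u \<in> V. \<exists>v \<in> V. u \<noteq> v \<and> e = {u, v})"

definition degree_in :: "'v set set \<Rightarrow> 'v \<Rightarrow> nat" where
  "degree_in E v = card {e \<in> E. v \<in> e}"

definition path_from :: "'v set \<Rightarrow> 'v set set \<Rightarrow> 'v \<Rightarrow> 'v list \<Rightarrow> bool" where
  "path_from V E v ps \<longleftrightarrow>
     ps \<noteq> [] \<and> hd ps = v \<and> set ps \<subseteq> V \<and> distinct ps \<and>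
     (\<forall>i. Suc i < length ps \<longrightarrow> {ps ! i, ps ! Suc i} \<in> E)"

definition maximal_path_from :: "'v set \<Rightarrow> 'v set set \<Rightarrow> 'v \<Rightarrow> 'v list \<Rightarrow> bool" where
  "maximal_path_from V E v ps \<longleftrightarrow> path_from V E v ps \<and> (\<forall>u. \<not> path_from V E v (ps @ [u]))"


section \<open>The garden-hose game\<close>

datatype vertex = Source | PA nat | PB nat  \<comment> \<open>\<open>0\<close>, \<open>i\<^sup>A\<close>, \<open>i\<^sup>B\<close>\<close>

definition side_A :: "nat \<Rightarrow> vertex set" where
  "side_A s = PA ` {1..s}"

definition side_A0 :: "nat \<Rightarrow> vertex set" where
  "side_A0 s = insert Source (side_A s)"

definition side_B :: "nat \<Rightarrow> vertex set" where
  "side_B s = PB ` {1..s}"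

definition pipes :: "nat \<Rightarrow> vertex set set" where
  "pipes s = {{PA i, PB i} |i. i \<in> {1..s}}"

definition garden_hose_game ::
  "nat \<Rightarrow> nat \<Rightarrow> (bool list \<Rightarrow> vertex set set) \<Rightarrow> (bool list \<Rightarrow> vertex set set) \<Rightarrow> bool" where
  "garden_hose_game n s EA EB \<longleftrightarrow>
     (\<forall>x. length x = n \<longrightarrow> edges_on (side_A0 s) (EA x) \<and> (\<forall>v \<in> side_A0 s. degree_in (EA x) v \<le> 1)) \<and>
     (\<forall>y. length y = n \<longrightarrow> edges_on (side_B s) (EB y) \<and> (\<forall>v \<in> side_B s. degree_in (EB y) v \<le> 1))"

definition hose_vertices :: "nat \<Rightarrow> vertex set" where
  "hose_vertices s = side_A0 s \<union> side_B s"

definition hose_edges ::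
  "nat \<Rightarrow> (bool list \<Rightarrow> vertex set set) \<Rightarrow> (bool list \<Rightarrow> vertex set set) \<Rightarrow>
   bool list \<Rightarrow> bool list \<Rightarrow> vertex set set" where
  "hose_edges s EA EB x y = pipes s \<union> EA x \<union> EB y"

text \<open>The path described here exists and is unique, see \<open>ex1_hose_path\<close> below.\<close>

definition hose_path ::
  "nat \<Rightarrow> (bool list \<Rightarrow> vertex set set) \<Rightarrow> (bool list \<Rightarrow> vertex set set) \<Rightarrow>
   bool list \<Rightarrow> bool list \<Rightarrow> vertex list" where
  "hose_path s EA EB x y =
     (THE ps. maximal_path_from (hose_vertices s) (hose_edges s EA EB x y) Source ps)"

definition game_computes ::
  "nat \<Rightarrow> nat \<Rightarrow> (bool list \<Rightarrow> vertex set set) \<Rightarrow> (bool list \<Rightarrow> vertex set set) \<Rightarrow>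
   (bool list \<Rightarrow> bool list \<Rightarrow> bool) \<Rightarrow> bool" where
  "game_computes n s EA EB h \<longleftrightarrow>
     (\<forall>x y. length x = n \<and> length y = n \<longrightarrow>
        (\<not> h x y \<longrightarrow> last (hose_path s EA EB x y) \<in> side_A0 s) \<and>
        (h x y \<longrightarrow> last (hose_path s EA EB x y) \<in> side_B s))"

text \<open>
  The argument \<open>n\<close> is the length of the inputs of \<open>h\<close>. The minimum is over a nonempty set, see
  \<open>ex_game_computes\<close> below.
\<close>

definition GH :: "nat \<Rightarrow> (bool list \<Rightarrow> bool list \<Rightarrow> bool) \<Rightarrow> nat" where
  "GH n h = (LEAST s. \<exists>EA EB. garden_hose_game n s EA EB \<and> game_computes n s EA EB h)"


section \<open>Well-definedness of \<open>hose_path\<close> and \<open>GH\<close>\<close>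

lemma three_edges_at:
  assumes "finite E" "degree_in E v \<le> 2" "{v, a} \<in> E" "{v, b} \<in> E" "{v, c} \<in> E"
    and "a \<noteq> b" "a \<noteq> c"
  shows "b = c"
proof (rule ccontr)
  assume "b \<noteq> c"
  then have "card {{v, a}, {v, b}, {v, c}} = 3"
    using assms(6,7) by (auto simp: card_insert_if doubleton_eq_iff)
  moreover have "card {{v, a}, {v, b}, {v, c}} \<le> card {e \<in> E. v \<in> e}"
    using assms by (intro card_mono) auto
  ultimately show False using assms(2) by (simp add: degree_in_def)
qed

lemma two_edges_at:
  assumes "finite E" "degree_in E v \<le> 1" "{v, b} \<in> E" "{v, c} \<in> E"
  shows "b = c"
proof (rule ccontr)
  assume "b \<noteq> c"
  then have "card {{v, b}, {v, c}} = 2"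
    by (auto simp: card_insert_if doubleton_eq_iff)
  moreover have "card {{v, b}, {v, c}} \<le> card {e \<in> E. v \<in> e}"
    using assms by (intro card_mono) auto
  ultimately show False using assms(2) by (simp add: degree_in_def)
qed

lemma path_from_agree:
  assumes E: "finite E" and d1: "degree_in E v \<le> 1" and d2: "\<And>u. u \<in> V \<Longrightarrow> degree_in E u \<le> 2"
    and p: "path_from V E v ps" and q: "path_from V E v qs"
  shows "i < length ps \<Longrightarrow> i < length qs \<Longrightarrow> ps ! i = qs ! i"
proof (induction i rule: less_induct)
  case (less i)
  show ?case
  proof (cases i)
    case 0
    then show ?thesis using p q by (auto simp: path_from_def simp flip: hd_conv_nth)
  next
    case (Suc j)
    have eq: "ps ! j = qs ! j" using less Suc by simp
    have ep: "{ps ! j, ps ! i} \<in> E" and eqq: "{ps ! j, qs ! i} \<in> E"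
      using p q less.prems Suc eq by (auto simp: path_from_def)
    show ?thesis
    proof (cases j)
      case 0
      then have "ps ! j = v" using p by (metis path_from_def hd_conv_nth)
      then show ?thesis using two_edges_at[OF E d1] ep eqq by metis
    next
      case (Suc k)
      have eq': "ps ! k = qs ! k" using less \<open>i = Suc j\<close> Suc by simp
      have ek: "{ps ! j, ps ! k} \<in> E"
        using p less.prems \<open>i = Suc j\<close> Suc by (auto simp: path_from_def insert_commute)
      have "ps ! k \<noteq> ps ! i" "qs ! k \<noteq> qs ! i"
        using p q less.prems \<open>i = Suc j\<close> Suc by (auto simp: path_from_def nth_eq_iff_index_eq)
      moreover have "ps ! j \<in> V"
        using p less.prems \<open>i = Suc j\<close> by (auto simp: path_from_def)
      ultimately show ?thesis using three_edges_at[OF E d2 ek ep eqq] eq' by metis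
    qed
  qed
qed

lemma path_from_take:
  assumes "path_from V E v ps" "k > 0"
  shows "path_from V E v (take k ps)"
  using assms by (auto simp: path_from_def hd_conv_nth dest: in_set_takeD)

lemma maximal_path_from_longest:
  assumes E: "finite E" and d1: "degree_in E v \<le> 1" and d2: "\<And>u. u \<in> V \<Longrightarrow> degree_in E u \<le> 2"
    and p: "maximal_path_from V E v ps" and q: "path_from V E v qs"
  shows "length qs \<le> length ps"
proof (rule ccontr)
  assume c: "\<not> ?thesis"
  have p': "path_from V E v ps" using p by (simp add: maximal_path_from_def)
  have "take (Suc (length ps)) qs = ps @ [qs ! length ps]"
    using c path_from_agree[OF E d1 d2 p' q]
    by (auto intro!: nth_equalityI simp: nth_append take_Suc_conv_app_nth less_Suc_eq)
  then have "path_from V E v (ps @ [qs ! length ps])"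
    using path_from_take[OF q, of "Suc (length ps)"] by simp
  then show False using p by (simp add: maximal_path_from_def)
qed

lemma ex1_maximal_path_from:
  assumes V: "finite V" "v \<in> V" and E: "finite E"
    and d1: "degree_in E v \<le> 1" and d2: "\<And>u. u \<in> V \<Longrightarrow> degree_in E u \<le> 2"
  shows "\<exists>!ps. maximal_path_from V E v ps"
proof -
  have start: "path_from V E v [v]" using V by (simp add: path_from_def)
  have bound: "length ps < Suc (card V)" if "path_from V E v ps" for ps
    using that V by (metis path_from_def card_mono distinct_card le_imp_less_Suc)
  have "\<exists>ps. path_from V E v ps \<and> (\<forall>qs. path_from V E v qs \<longrightarrow> length qs \<le> length ps)"
    using start bound by (intro ex_has_greatest_nat[of "path_from V E v" _ length]) auto
  then obtain ps where ps: "path_from V E v ps"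
      "\<And>qs. path_from V E v qs \<Longrightarrow> length qs \<le> length ps" by blast
  have max: "maximal_path_from V E v ps"
    unfolding maximal_path_from_def using ps(1) ps(2)[of "ps @ [_]"] by fastforce
  show ?thesis
  proof (rule ex1I[where a = ps])
    show "maximal_path_from V E v ps" by (fact max)
  next
    fix qs assume qs: "maximal_path_from V E v qs"
    then have qs': "path_from V E v qs" by (simp add: maximal_path_from_def)
    have "length qs = length ps"
      using maximal_path_from_longest[OF E d1 d2 max qs'] maximal_path_from_longest[OF E d1 d2 qs ps(1)]
      by simp
    then show "qs = ps"
      using path_from_agree[OF E d1 d2 qs' ps(1)] by (simp add: list_eq_iff_nth_eq)
  qed
qed

lemma finite_edges_on: "finite V \<Longrightarrow> edges_on V E \<Longrightarrow> finite E"
  by (rule finite_subset[of _ "Pow V"]) (auto simp: edges_on_def)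

lemma degree_in_Un: "degree_in (E \<union> F) v \<le> degree_in E v + degree_in F v"
  unfolding degree_in_def by (rule order_trans[OF _ card_Un_le]) (simp add: Collect_disj_eq conj_disj_distribR)

lemma degree_in_outside: "edges_on V E \<Longrightarrow> v \<notin> V \<Longrightarrow> degree_in E v = 0"
  by (auto simp: degree_in_def edges_on_def card_eq_0_iff)

lemma degree_in_pipes: "degree_in (pipes s) v \<le> (if v = Source then 0 else 1)"
proof (cases v)
  case Source
  then show ?thesis by (auto simp: degree_in_def pipes_def card_eq_0_iff)
next
  case (PA i)
  then have "{e \<in> pipes s. v \<in> e} \<subseteq> {{PA i, PB i}}" by (auto simp: pipes_def)
  then show ?thesis using PA card_mono[of "{{PA i, PB i}}"] by (fastforce simp: degree_in_def)
next
  case (PB i)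
  then have "{e \<in> pipes s. v \<in> e} \<subseteq> {{PA i, PB i}}" by (auto simp: pipes_def)
  then show ?thesis using PB card_mono[of "{{PA i, PB i}}"] by (fastforce simp: degree_in_def)
qed

lemma ex1_hose_path:
  assumes G: "garden_hose_game n s EA EB" and x: "length x = n" and y: "length y = n"
  shows "\<exists>!ps. maximal_path_from (hose_vertices s) (hose_edges s EA EB x y) Source ps"
proof -
  have fin: "finite (side_A0 s)" "finite (side_B s)" "finite (pipes s)"
    by (auto simp: side_A0_def side_A_def side_B_def pipes_def)
  have A: "edges_on (side_A0 s) (EA x)" "\<And>v. v \<in> side_A0 s \<Longrightarrow> degree_in (EA x) v \<le> 1"
    and B: "edges_on (side_B s) (EB y)" "\<And>v. v \<in> side_B s \<Longrightarrow> degree_in (EB y) v \<le> 1"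
    using G x y by (auto simp: garden_hose_game_def)
  have disj: "side_A0 s \<inter> side_B s = {}" "Source \<in> side_A0 s"
    by (auto simp: side_A0_def side_A_def side_B_def)
  have AB: "degree_in (EA x) v + degree_in (EB y) v \<le> 1" if "v \<in> hose_vertices s" for v
  proof (cases "v \<in> side_A0 s")
    case True
    then have "v \<notin> side_B s" using disj by blast
    then show ?thesis using A(2)[OF True] degree_in_outside[OF B(1)] by simp
  next
    case False
    then have "v \<in> side_B s" using that by (simp add: hose_vertices_def)
    then show ?thesis using B(2) degree_in_outside[OF A(1) False] by simp
  qed
  have deg: "degree_in (hose_edges s EA EB x y) v \<le> (if v = Source then 1 else 2)"
    if "v \<in> hose_vertices s" for v
    using AB[OF that] degree_in_pipes[of s v] degree_in_Un[of "pipes s" "EA x" v]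
      degree_in_Un[of "pipes s \<union> EA x" "EB y" v]
    by (auto simp: hose_edges_def split: if_splits)
  have S: "Source \<in> hose_vertices s" using disj by (simp add: hose_vertices_def)
  show ?thesis
  proof (rule ex1_maximal_path_from)
    show "finite (hose_vertices s)" "finite (hose_edges s EA EB x y)"
      using fin finite_edges_on[OF _ A(1)] finite_edges_on[OF _ B(1)]
      by (auto simp: hose_vertices_def hose_edges_def)
    show "degree_in (hose_edges s EA EB x y) Source \<le> 1" using deg[OF S] by simp
    show "degree_in (hose_edges s EA EB x y) u \<le> 2" if "u \<in> hose_vertices s" for u
      using deg[OF that] by (auto split: if_splits)
  qed (fact S)
qed

lemma hose_path_eqI:
  assumes "garden_hose_game n s EA EB" "length x = n" "length y = n"
    and "maximal_path_from (hose_vertices s) (hose_edges s EA EB x y) Source ps"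
  shows "hose_path s EA EB x y = ps"
  unfolding hose_path_def using assms(4) ex1_hose_path[OF assms(1-3)] by (rule the1_equality[rotated])

lemma path_from_iff:
  "path_from V E v ps \<longleftrightarrow>
     ps \<noteq> [] \<and> hd ps = v \<and> set ps \<subseteq> V \<and> distinct ps \<and> successively (\<lambda>a b. {a, b} \<in> E) ps"
  by (simp add: path_from_def successively_conv_nth)

lemma ex_game_computes:
  "\<exists>s EA EB. garden_hose_game n s EA EB \<and> game_computes n s EA EB h"
proof -
  define X :: "bool list set" where "X = {x. length x = n}"
  define N where "N = card X"
  have "finite X" unfolding X_def using finite_lists_length_eq[of "UNIV :: bool set" n] by simp
  then obtain enc where enc: "bij_betw enc X {1..N}"
    unfolding N_def using finite_same_card_bij[of X "{1..card X}"] by auto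
  have inj: "enc x = enc x' \<longleftrightarrow> x = x'" if "length x = n" "length x' = n" for x x'
    using enc that by (auto simp: bij_betw_def inj_on_def X_def)
  have ran: "1 \<le> enc x" "enc x \<le> N" if "length x = n" for x
    using bij_betwE[OF enc] that by (auto simp: X_def)
  have ran': "enc x' \<noteq> N + enc x" "N + enc x \<noteq> enc x'" if "length x = n" "length x' = n" for x x'
    using ran[OF that(1)] ran[OF that(2)] by auto
  define s where "s = 2 * N"
  define EA where "EA x = {{Source, PA (enc x)}}" for x
  define EB where "EB y = {{PB (enc x), PB (N + enc x)} |x. length x = n \<and> \<not> h x y}" for y
  have G: "garden_hose_game n s EA EB"
    unfolding garden_hose_game_def
  proof (intro conjI allI impI ballI)
    fix x :: "bool list" assume x: "length x = n"
    show "edges_on (side_A0 s) (EA x)"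
      using ran[OF x] by (auto simp: edges_on_def EA_def side_A0_def side_A_def s_def)
    fix v
    have "card {e \<in> EA x. v \<in> e} \<le> card (EA x)"
      by (intro card_mono) (auto simp: EA_def)
    then show "degree_in (EA x) v \<le> 1" by (simp add: degree_in_def EA_def)
  next
    fix y :: "bool list"
    have "\<exists>u\<in>side_B s. \<exists>v\<in>side_B s. u \<noteq> v \<and> {PB (enc x), PB (N + enc x)} = {u, v}"
      if "length x = n" for x
      using ran[OF that] by (intro bexI[of _ "PB (enc x)"] bexI[of _ "PB (N + enc x)"])
        (auto simp: side_B_def s_def)
    then show "edges_on (side_B s) (EB y)"
      by (auto simp: edges_on_def EB_def)
    fix v
    have "e = e'" if e: "e \<in> EB y" "v \<in> e" "e' \<in> EB y" "v \<in> e'" for e e'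
    proof -
      obtain x x' where x: "length x = n" "e = {PB (enc x), PB (N + enc x)}"
        and x': "length x' = n" "e' = {PB (enc x'), PB (N + enc x')}"
        using e unfolding EB_def by blast
      have "enc x = enc x'"
        using e x(2) x'(2) ran'[OF x(1) x'(1)] ran'[OF x'(1) x(1)] by auto
      then show "e = e'" using x(2) x'(2) by simp
    qed
    moreover have "finite {e \<in> EB y. v \<in> e}"
      using \<open>finite X\<close> by (simp add: EB_def X_def)
    ultimately show "degree_in (EB y) v \<le> 1"
      unfolding degree_in_def One_nat_def by (subst card_le_Suc0_iff_eq) auto
  qed
  have "game_computes n s EA EB h"
    unfolding game_computes_def
  proof (intro allI impI)
    fix x y :: "bool list" assume xy: "length x = n \<and> length y = n"
    have r: "1 \<le> enc x" "enc x \<le> N" using ran xy by auto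
    note V = hose_vertices_def side_A0_def side_A_def side_B_def s_def
    have edges: "{Source, PA (enc x)} \<in> hose_edges s EA EB x y"
      "\<And>i. 1 \<le> i \<Longrightarrow> i \<le> 2 * N \<Longrightarrow> {PA i, PB i} \<in> hose_edges s EA EB x y"
      by (auto simp: hose_edges_def EA_def pipes_def s_def)
    show "(\<not> h x y \<longrightarrow> last (hose_path s EA EB x y) \<in> side_A0 s) \<and>
          (h x y \<longrightarrow> last (hose_path s EA EB x y) \<in> side_B s)"
    proof (cases "h x y")
      case True
      let ?p = "[Source, PA (enc x), PB (enc x)]"
      have "path_from (hose_vertices s) (hose_edges s EA EB x y) Source ?p"
        using edges r by (auto simp: path_from_iff V)
      moreover have "\<not> path_from (hose_vertices s) (hose_edges s EA EB x y) Source (?p @ [u])" for u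
      proof
        assume "path_from (hose_vertices s) (hose_edges s EA EB x y) Source (?p @ [u])"
        then have "{PB (enc x), u} \<in> hose_edges s EA EB x y" "u \<noteq> PA (enc x)"
          by (auto simp: path_from_iff)
        moreover have "{PB (enc x), u} \<notin> EB y"
        proof
          assume "{PB (enc x), u} \<in> EB y"
          then obtain x' where x': "length x' = n" "\<not> h x' y"
            and e: "{PB (enc x), u} = {PB (enc x'), PB (N + enc x')}"
            by (auto simp: EB_def)
          have "enc x \<noteq> N + enc x'" using r ran(1)[OF x'(1)] by simp
          then have "enc x = enc x'" using e by (auto simp: doubleton_eq_iff)
          then show False using inj[of x x'] xy x' True by simp
        qed
        ultimately show False
          by (auto simp: hose_edges_def EA_def pipes_def doubleton_eq_iff)
      qed
      ultimately have "hose_path s EA EB x y = ?p"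
        using xy by (intro hose_path_eqI[OF G]) (auto simp: maximal_path_from_def)
      then show ?thesis using True r by (simp add: side_B_def s_def)
    next
      case False
      let ?p = "[Source, PA (enc x), PB (enc x), PB (N + enc x), PA (N + enc x)]"
      have "{PB (enc x), PB (N + enc x)} \<in> hose_edges s EA EB x y"
        using False xy by (auto simp: hose_edges_def EB_def)
      moreover have "{PB (N + enc x), PA (N + enc x)} \<in> hose_edges s EA EB x y"
        using edges(2)[of "N + enc x"] r by (simp add: insert_commute)
      ultimately have "path_from (hose_vertices s) (hose_edges s EA EB x y) Source ?p"
        using edges r by (auto simp: path_from_iff V)
      moreover have "\<not> path_from (hose_vertices s) (hose_edges s EA EB x y) Source (?p @ [u])" for u
      proof
        assume "path_from (hose_vertices s) (hose_edges s EA EB x y) Source (?p @ [u])"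
        then have "{PA (N + enc x), u} \<in> hose_edges s EA EB x y" "u \<noteq> PB (N + enc x)"
          by (auto simp: path_from_iff)
        then show False using r
          by (auto simp: hose_edges_def EA_def EB_def pipes_def doubleton_eq_iff)
      qed
      ultimately have "hose_path s EA EB x y = ?p"
        using xy by (intro hose_path_eqI[OF G]) (auto simp: maximal_path_from_def)
      then show ?thesis using False r by (simp add: side_A0_def side_A_def s_def)
    qed
  qed
  with G show ?thesis by blast
qed

end

theory Submission
  imports Defs "HOL-Library.FuncSet"
begin

text \<open>
  On inputs of length \<open>2 n\<close> the machine has only polynomially many configurations. Iterating its
  step function gives a forest of pairs (time, configuration), in which the start node must be
  followed to its root. The step function is not injective, but the Euler tour around a forest is
  reversible: each node is passed once downwards and once upwards, and following the tour from the
  upward passage of the start leads to the upward passage of its root. Each passage is one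
  pipe, and the two ends of a pipe correspond to the two adjacent time layers. By letting Alice and
  Bob alternately advance the configuration, each only if the input head is on his or her part of
  the input, each layer of the forest is known to a single player.
\<close>

section \<open>Games from alternating partial injections\<close>

text \<open>Whenever a walk returns to \<open>a\<close>, the part before the return can be
  discarded. This permits the removal of all edges into the pipe \<open>q0\<close>.\<close>

lemma rtrancl_avoid_target:
  assumes "(a, b) \<in> R\<^sup>*"
  shows "(a, b) \<in> (R - UNIV \<times> {a})\<^sup>*"
  using assms
proof (induction rule: rtrancl_induct)
  case (step y z)
  then show ?case
    by (cases "z = a") (auto intro: rtrancl_into_rtrancl)
qed simp

text \<open>Predecessors are unique, so a cycle through a vertex also contains its predecessor on
  the walk from \<open>a\<close>. Going back along the walk puts \<open>a\<close> on a cycle, but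
  \<open>a\<close> has no predecessor.\<close>

lemma no_cycle_from_source:
  assumes "single_valued (R\<inverse>)" "a \<notin> Range R" "(a, b) \<in> R\<^sup>*"
  shows "(b, b) \<notin> R\<^sup>+"
  using assms(3)
proof (induction rule: rtrancl_induct)
  case base
  then show ?case using assms(2) by (auto dest: tranclD2)
next
  case (step y z)
  show ?case
  proof
    assume "(z, z) \<in> R\<^sup>+"
    then obtain y' where "(z, y') \<in> R\<^sup>*" "(y', z) \<in> R" by (blast dest: tranclD2)
    moreover have "y' = y"
      using assms(1) \<open>(y', z) \<in> R\<close> step.hyps(2) by (auto simp: single_valued_def)
    ultimately have "(y, y) \<in> R\<^sup>+" using step.hyps(2) by (blast intro: rtrancl_into_trancl2)
    then show False using step.IH by blast
  qed
qed

text \<open>As domain and range are disjoint, a vertex common to two edges is the first component of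
  both pairs or the second component of both. Single-valuedness in the corresponding direction
  identifies the edges.\<close>

lemma degree_in_matching:
  assumes "single_valued R" "single_valued (R\<inverse>)" "Domain R \<inter> Range R = {}" "finite R"
  shows "degree_in {{a, b} |a b. (a, b) \<in> R} v \<le> 1"
proof -
  define E where "E = {{a, b} |a b. (a, b) \<in> R}"
  have "E = (\<lambda>(a, b). {a, b}) ` R" by (auto simp: E_def)
  then have "finite E" using assms(4) by simp
  moreover have "e = e'" if ee: "e \<in> E" "v \<in> e" "e' \<in> E" "v \<in> e'" for e e'
  proof -
    obtain a b where e: "e = {a, b}" "(a, b) \<in> R" using ee(1) unfolding E_def by blast
    obtain a' b' where e': "e' = {a', b'}" "(a', b') \<in> R" using ee(3) unfolding E_def by blast
    have "a \<noteq> b'" "a' \<noteq> b" using e(2) e'(2) assms(3) by blast+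
    then have "a = a' \<or> b = b'" using e(1) e'(1) ee(2,4) by auto
    then have "a = a' \<and> b = b'"
      using assms(1,2) e(2) e'(2) by (auto simp: single_valued_def)
    then show ?thesis using e e' by simp
  qed
  ultimately show ?thesis
    unfolding degree_in_def One_nat_def E_def[symmetric] by (subst card_le_Suc0_iff_eq) auto
qed

lemma edges_on_matching:
  assumes "R \<subseteq> V \<times> V" "Domain R \<inter> Range R = {}"
  shows "edges_on V {{a, b} |a b. (a, b) \<in> R}"
  unfolding edges_on_def
proof
  fix e assume "e \<in> {{a, b} |a b. (a, b) \<in> R}"
  then obtain a b where "e = {a, b}" "(a, b) \<in> R" by blast
  then show "\<exists>u\<in>V. \<exists>v\<in>V. u \<noteq> v \<and> e = {u, v}"
    using assms by (intro bexI[of _ a] bexI[of _ b]) auto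
qed

text \<open>
  The elements of \<open>S\<close> are the pipes and \<open>col q\<close> says that the water enters \<open>q\<close> on Alice's side.
  The edges into \<open>q0\<close> are dropped, since \<open>q0\<close> is connected to the source.
\<close>

lemma GH_le_card:
  fixes S :: "'a set"
  assumes S: "finite S" "q0 \<in> S" "col q0"
    and RA: "\<And>x. length x = n \<Longrightarrow> RA x \<subseteq> {q \<in> S. \<not> col q} \<times> {q \<in> S. col q}"
    and RA1: "\<And>x. length x = n \<Longrightarrow> single_valued (RA x)"
    and RA2: "\<And>x. length x = n \<Longrightarrow> single_valued ((RA x)\<inverse>)"
    and RB: "\<And>y. length y = n \<Longrightarrow> RB y \<subseteq> {q \<in> S. col q} \<times> {q \<in> S. \<not> col q}"
    and RB1: "\<And>y. length y = n \<Longrightarrow> single_valued (RB y)"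
    and RB2: "\<And>y. length y = n \<Longrightarrow> single_valued ((RB y)\<inverse>)"
    and ends: "\<And>x y. length x = n \<Longrightarrow> length y = n \<Longrightarrow>
      \<exists>q. (q0, q) \<in> (RA x \<union> RB y)\<^sup>* \<and> q \<notin> Domain (RA x \<union> RB y) \<and> col q = h x y"
  shows "GH n h \<le> card S"
proof -
  define s where "s = card S"
  obtain enc where enc: "bij_betw enc S {1..s}"
    using S(1) unfolding s_def using finite_same_card_bij[of S "{1..card S}"] by auto
  have inj: "enc q = enc r \<longleftrightarrow> q = r" if "q \<in> S" "r \<in> S" for q r
    using enc that by (auto simp: bij_betw_def inj_on_def)
  have ran: "enc q \<in> {1..s}" if "q \<in> S" for q
    using bij_betwE[OF enc] that by auto
  have vert: "Source \<in> side_A0 s" "q \<in> S \<Longrightarrow> PA (enc q) \<in> side_A0 s" "q \<in> S \<Longrightarrow> PB (enc q) \<in> side_B s"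
    for q using ran[of q] by (auto simp: side_A0_def side_A_def side_B_def)
  \<comment> \<open>An edge of \<open>RA x\<close> joins the Alice ends of two pipes: water leaves
    \<open>q\<close> there and enters \<open>r\<close> there. The source takes the place of the
    predecessors of \<open>q0\<close>, which keeps the degrees at most 1.\<close>
  define VA where "VA x = insert (Source, PA (enc q0))
     ((\<lambda>(q, r). (PA (enc q), PA (enc r))) ` (RA x - UNIV \<times> {q0}))" for x
  define VB where "VB y = (\<lambda>(q, r). (PB (enc q), PB (enc r))) ` RB y" for y
  define EA where "EA x = {{a, b} |a b. (a, b) \<in> VA x}" for x
  define EB where "EB y = {{a, b} |a b. (a, b) \<in> VB y}" for y
  have RAD: "q \<in> S" "r \<in> S" "\<not> col q" "col r" if "(q, r) \<in> RA x" "length x = n" for q r x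
    using RA[OF that(2)] that(1) by auto
  have RBD: "q \<in> S" "r \<in> S" "col q" "\<not> col r" if "(q, r) \<in> RB y" "length y = n" for q r y
    using RB[OF that(2)] that(1) by auto
  have G: "garden_hose_game n s EA EB"
    unfolding garden_hose_game_def
  proof (intro conjI allI impI ballI)
    fix x :: "bool list" assume x: "length x = n"
    note D = RAD[OF _ x]
    have "finite (RA x)"
      using RA[OF x] by (rule finite_subset) (use S in auto)
    then have f: "finite (VA x)" by (simp add: VA_def)
    have sv: "single_valued (VA x)"
      using RA1[OF x] by (auto simp: VA_def single_valued_def inj D)
    have sv': "single_valued ((VA x)\<inverse>)"
      using RA2[OF x] S(2) by (auto simp: VA_def single_valued_def inj D)
    have dis: "Domain (VA x) \<inter> Range (VA x) = {}"
      using D S(2,3) by (auto simp: VA_def) (metis inj)+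
    have "VA x \<subseteq> side_A0 s \<times> side_A0 s"
      using S(2) by (auto simp: VA_def intro: vert D(1,2))
    then show "edges_on (side_A0 s) (EA x)" unfolding EA_def by (rule edges_on_matching[OF _ dis])
    show "degree_in (EA x) v \<le> 1" for v unfolding EA_def by (rule degree_in_matching[OF sv sv' dis f])
  next
    fix y :: "bool list" assume y: "length y = n"
    note D = RBD[OF _ y]
    have "finite (RB y)"
      using RB[OF y] by (rule finite_subset) (use S in auto)
    then have f: "finite (VB y)" by (simp add: VB_def)
    have sv: "single_valued (VB y)"
      using RB1[OF y] by (auto simp: VB_def single_valued_def inj D)
    have sv': "single_valued ((VB y)\<inverse>)"
      using RB2[OF y] by (auto simp: VB_def single_valued_def inj D)
    have dis: "Domain (VB y) \<inter> Range (VB y) = {}"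
      using D by (auto simp: VB_def) (metis inj)+
    have "VB y \<subseteq> side_B s \<times> side_B s"
      by (auto simp: VB_def intro: vert D(1,2))
    then show "edges_on (side_B s) (EB y)" unfolding EB_def by (rule edges_on_matching[OF _ dis])
    show "degree_in (EB y) v \<le> 1" for v unfolding EB_def by (rule degree_in_matching[OF sv sv' dis f])
  qed
  have "game_computes n s EA EB h"
    unfolding game_computes_def
  proof (intro allI impI)
    fix x y :: "bool list" assume "length x = n \<and> length y = n"
    then have x: "length x = n" and y: "length y = n" by auto
    let ?V = "hose_vertices s" and ?E = "hose_edges s EA EB x y"
    define R where "R = (RA x \<union> RB y) - UNIV \<times> {q0}"
    \<comment> \<open>The ends of pipe \<open>q\<close> are named by the direction of flow, so that
      both players' edges take the form \<open>{exit q, entry r}\<close>.\<close>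
    define entry where "entry q = (if col q then PA (enc q) else PB (enc q))" for q
    define exit where "exit q = (if col q then PB (enc q) else PA (enc q))" for q
    have pipe: "{entry q, exit q} \<in> ?E" "{exit q, entry q} \<in> ?E" "{entry q, exit q} \<subseteq> ?V"
      if "q \<in> S" for q
      using ran[OF that]
      by (auto simp: entry_def exit_def hose_edges_def pipes_def hose_vertices_def side_A0_def
          side_A_def side_B_def insert_commute)
    have link: "{exit q, entry r} \<in> ?E" if "(q, r) \<in> R" for q r
    proof (cases "(q, r) \<in> RA x")
      case True
      then have "(PA (enc q), PA (enc r)) \<in> VA x" using that by (force simp: VA_def R_def)
      then have "{PA (enc q), PA (enc r)} \<in> EA x" by (auto simp: EA_def)
      then show ?thesis using RAD[OF True x] by (simp add: hose_edges_def entry_def exit_def)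
    next
      case False
      then have B: "(q, r) \<in> RB y" using that by (simp add: R_def)
      then have "(PB (enc q), PB (enc r)) \<in> VB y" by (force simp: VB_def)
      then have "{PB (enc q), PB (enc r)} \<in> EB y" by (auto simp: EB_def)
      then show ?thesis using RBD[OF B y] by (simp add: hose_edges_def entry_def exit_def)
    qed
    have RS: "q \<in> S" "r \<in> S" if "(q, r) \<in> R" for q r
      using that RAD[OF _ x] RBD[OF _ y] by (auto simp: R_def)
    have inv: "single_valued (R\<inverse>)"
      using RA2[OF x] RB2[OF y] by (auto simp: R_def single_valued_def dest: RAD[OF _ x] RBD[OF _ y])
    \<comment> \<open>The invariant locates the path inside the pipes from which \<open>q\<close> is
      reachable. As no cycle is reachable from \<open>q0\<close>, the next pipe is not among these,
      which keeps the path simple.\<close>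
    have path: "\<exists>ps. path_from ?V ?E Source ps \<and> last ps = exit q \<and> entry q \<in> set ps \<and>
        set ps \<subseteq> insert Source (\<Union>r \<in> {r \<in> S. (r, q) \<in> R\<^sup>*}. {entry r, exit r})"
      if "(q0, q) \<in> R\<^sup>*" for q
      using that
    proof (induction rule: rtrancl_induct)
      case base
      have "{Source, entry q0} \<in> ?E"
        using S(3) by (auto simp: hose_edges_def EA_def VA_def entry_def)
      moreover have "Source \<in> ?V" by (simp add: hose_vertices_def side_A0_def)
      ultimately have "path_from ?V ?E Source [Source, entry q0, exit q0]"
        using pipe[OF S(2)] by (auto simp: path_from_iff entry_def exit_def)
      then show ?case using S(2) by (intro exI[of _ "[Source, entry q0, exit q0]"]) auto
    next
      case (step q r)
      then obtain ps where ps: "path_from ?V ?E Source ps" "last ps = exit q"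
        "set ps \<subseteq> insert Source (\<Union>r \<in> {r \<in> S. (r, q) \<in> R\<^sup>*}. {entry r, exit r})" by blast
      have r: "r \<in> S" using RS step.hyps by blast
      have "(r, r) \<notin> R\<^sup>+"
        using inv by (rule no_cycle_from_source[of _ q0])
          (auto simp: R_def intro: rtrancl_into_rtrancl[OF step.hyps, unfolded R_def])
      then have nr: "(r, q) \<notin> R\<^sup>*" using step.hyps(2) by (blast intro: rtrancl_into_trancl1)
      have "v \<notin> {entry r, exit r}" if "v \<in> set ps" for v
      proof -
        have "v = Source \<or> (\<exists>z\<in>S. (z, q) \<in> R\<^sup>* \<and> v \<in> {entry z, exit z})" using ps(3) that by blast
        then show ?thesis
        proof (elim disjE bexE conjE)
          fix z assume z: "z \<in> S" "(z, q) \<in> R\<^sup>*" "v \<in> {entry z, exit z}"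
          then have "enc z \<noteq> enc r" using nr inj[OF z(1) r] by metis
          then show ?thesis using z(3) by (auto simp: entry_def exit_def split: if_splits)
        qed (simp add: entry_def exit_def)
      qed
      then have new: "entry r \<notin> set ps" "exit r \<notin> set ps" "entry r \<noteq> exit r"
        by (blast, blast, simp add: entry_def exit_def)
      have "path_from ?V ?E Source (ps @ [entry r, exit r])"
        using ps(1,2) new pipe[OF r] link[OF step.hyps(2)]
        by (auto simp: path_from_iff successively_append_iff)
      moreover have "set (ps @ [entry r, exit r]) \<subseteq>
          insert Source (\<Union>z \<in> {z \<in> S. (z, r) \<in> R\<^sup>*}. {entry z, exit z})"
      proof -
        have "(z, r) \<in> R\<^sup>*" if "(z, q) \<in> R\<^sup>*" for z
          using that step.hyps(2) by (rule rtrancl_into_rtrancl)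
        then have "set ps \<subseteq> insert Source (\<Union>z \<in> {z \<in> S. (z, r) \<in> R\<^sup>*}. {entry z, exit z})"
          using ps(3) by blast
        then show ?thesis using r by auto
      qed
      ultimately show ?case by (intro exI[of _ "ps @ [entry r, exit r]"] conjI) simp_all
    qed
    obtain q where q: "(q0, q) \<in> (RA x \<union> RB y)\<^sup>*" "q \<notin> Domain (RA x \<union> RB y)" "col q = h x y"
      using ends[OF x y] by blast
    have qR: "(q0, q) \<in> R\<^sup>*" unfolding R_def using q(1) by (rule rtrancl_avoid_target)
    have qS: "q \<in> S" using qR S(2) RS by (metis rtranclE)
    obtain ps where ps: "path_from ?V ?E Source ps" "last ps = exit q" "entry q \<in> set ps"
      using path[OF qR] by blast
    \<comment> \<open>At \<open>exit q\<close> there are only the pipe itself, whose other end is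
      already on the path, and edges that leave \<open>q\<close>, of which there are none. Edges
      into \<open>q\<close> and the source edge attach at entry ends.\<close>
    have "\<not> path_from ?V ?E Source (ps @ [u])" for u
    proof
      assume "path_from ?V ?E Source (ps @ [u])"
      then have e: "{exit q, u} \<in> ?E" and u: "u \<noteq> entry q"
        using ps by (auto simp: path_from_iff successively_append_iff)
      have "{exit q, u} \<notin> pipes s"
        using u ran[OF qS] by (auto simp: pipes_def exit_def entry_def doubleton_eq_iff split: if_splits)
      moreover have "{exit q, u} \<notin> EA x"
      proof
        assume "{exit q, u} \<in> EA x"
        then consider z r where "(z, r) \<in> RA x" "exit q = PA (enc z) \<or> exit q = PA (enc r)"
          | "exit q = PA (enc q0)" | "exit q = Source"
          by (auto simp: EA_def VA_def doubleton_eq_iff)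
        then show False
        proof cases
          case 1
          then have "\<not> col q" "q = z \<or> q = r"
            using inj[OF qS] RAD[OF 1(1) x] by (auto simp: exit_def split: if_splits)
          then show False using q(2) 1(1) RAD[OF 1(1) x] by blast
        next
          case 2
          then show False using inj[OF qS S(2)] S(3) by (auto simp: exit_def split: if_splits)
        qed (simp add: exit_def split: if_splits)
      qed
      moreover have "{exit q, u} \<notin> EB y"
      proof
        assume "{exit q, u} \<in> EB y"
        then obtain z r where zr: "(z, r) \<in> RB y" "exit q = PB (enc z) \<or> exit q = PB (enc r)"
          by (auto simp: EB_def VB_def doubleton_eq_iff)
        then have "col q" "q = z \<or> q = r"
          using inj[OF qS] RBD[OF zr(1) y] by (auto simp: exit_def split: if_splits)
        then show False using q(2) zr(1) RBD[OF zr(1) y] by blast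
      qed
      ultimately show False using e by (simp add: hose_edges_def)
    qed
    then have "hose_path s EA EB x y = ps"
      using ps(1) by (intro hose_path_eqI[OF G x y]) (simp add: maximal_path_from_def)
    then show "(\<not> h x y \<longrightarrow> last (hose_path s EA EB x y) \<in> side_A0 s) \<and>
          (h x y \<longrightarrow> last (hose_path s EA EB x y) \<in> side_B s)"
      using ps(2) q(3) ran[OF qS] by (auto simp: exit_def side_A0_def side_A_def side_B_def)
  qed
  with G show ?thesis
    unfolding GH_def s_def[symmetric] by (intro Least_le) blast
qed

section \<open>Euler tours of forests\<close>

datatype 'v arc = Down 'v | Up 'v

text \<open>
  The Euler tour of the forest with parent function \<open>p\<close>, where siblings are ordered by \<open>key\<close>; the set
  \<open>U\<close> contains the nodes that are leaves when \<open>p\<close> gives them no child.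
\<close>

inductive_set tour :: "('v \<Rightarrow> nat) \<Rightarrow> ('v \<Rightarrow> 'v option) \<Rightarrow> 'v set \<Rightarrow> ('v arc \<times> 'v arc) set"
  for key p U where
  first: "p v = Some u \<Longrightarrow> (\<And>w. p w = Some u \<Longrightarrow> key v \<le> key w) \<Longrightarrow> (Down u, Down v) \<in> tour key p U"
| leaf: "u \<in> U \<Longrightarrow> (\<And>v. p v \<noteq> Some u) \<Longrightarrow> (Down u, Up u) \<in> tour key p U"
| sibling: "p v = Some u \<Longrightarrow> p w = Some u \<Longrightarrow> key v < key w \<Longrightarrow>
    (\<And>z. p z = Some u \<Longrightarrow> key z \<le> key v \<or> key w \<le> key z) \<Longrightarrow> (Up v, Down w) \<in> tour key p U"
| last: "p v = Some u \<Longrightarrow> (\<And>w. p w = Some u \<Longrightarrow> key w \<le> key v) \<Longrightarrow> (Up v, Up u) \<in> tour key p U"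

section \<open>Reversibility of the Euler tour\<close>

lemma tour_from_Down:
  "(Down u, q) \<in> tour key p U \<longleftrightarrow>
     (\<exists>v. q = Down v \<and> p v = Some u \<and> (\<forall>w. p w = Some u \<longrightarrow> key v \<le> key w)) \<or>
     (q = Up u \<and> u \<in> U \<and> (\<forall>v. p v \<noteq> Some u))"
  by (subst tour.simps) (simp; blast)

lemma tour_from_Up:
  "(Up v, q) \<in> tour key p U \<longleftrightarrow>
     (\<exists>u w. q = Down w \<and> p v = Some u \<and> p w = Some u \<and> key v < key w \<and>
        (\<forall>z. p z = Some u \<longrightarrow> key z \<le> key v \<or> key w \<le> key z)) \<or>
     (\<exists>u. q = Up u \<and> p v = Some u \<and> (\<forall>w. p w = Some u \<longrightarrow> key w \<le> key v))"
  by (subst tour.simps) (simp; blast)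

text \<open>Distinct keys make the first child and the next sibling unique, and the alternatives
  exclude each other: a node has a first child or is a leaf, a child has a next sibling or is the
  last one.\<close>

lemma single_valued_tour:
  assumes "inj_on key (dom p)"
  shows "single_valued (tour key p U)"
proof -
  have eq: "v = w" if "p v = Some u" "p w = Some u" "key v \<le> key w" "key w \<le> key v" for u v w
    using inj_onD[OF assms, of v w] that by force
  have "q = r" if "(a, q) \<in> tour key p U" "(a, r) \<in> tour key p U" for a q r
  proof (cases a)
    case (Down u)
    show ?thesis
      using that unfolding Down tour_from_Down by (elim disjE exE conjE) (use eq in \<open>simp; blast\<close>)+
  next
    case (Up v)
    show ?thesis
      using that unfolding Up tour_from_Up
      by (elim disjE exE conjE) (metis eq option.inject leD)+
  qed
  then show ?thesis by (auto simp: single_valued_def)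
qed

lemma tour_to_Down:
  "(q, Down w) \<in> tour key p U \<longleftrightarrow>
     (\<exists>u. q = Down u \<and> p w = Some u \<and> (\<forall>z. p z = Some u \<longrightarrow> key w \<le> key z)) \<or>
     (\<exists>u v. q = Up v \<and> p v = Some u \<and> p w = Some u \<and> key v < key w \<and>
        (\<forall>z. p z = Some u \<longrightarrow> key z \<le> key v \<or> key w \<le> key z))"
  by (subst tour.simps) (simp; blast)

lemma tour_to_Up:
  "(q, Up u) \<in> tour key p U \<longleftrightarrow>
     (q = Down u \<and> u \<in> U \<and> (\<forall>v. p v \<noteq> Some u)) \<or>
     (\<exists>v. q = Up v \<and> p v = Some u \<and> (\<forall>w. p w = Some u \<longrightarrow> key w \<le> key v))"
  by (subst tour.simps) (simp; blast)

text \<open>Read backwards, the rules again determine a unique neighbour: previous sibling or parent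
  for \<open>Down\<close>, last child or leaf turn for \<open>Up\<close>. The parent function
  \<open>p\<close> itself need not be injective.\<close>

lemma single_valued_converse_tour:
  assumes "inj_on key (dom p)"
  shows "single_valued ((tour key p U)\<inverse>)"
proof -
  have eq: "v = w" if "p v = Some u" "p w = Some u" "key v \<le> key w" "key w \<le> key v" for u v w
    using inj_onD[OF assms, of v w] that by force
  have "q = r" if "(q, a) \<in> tour key p U" "(r, a) \<in> tour key p U" for a q r
  proof (cases a)
    case (Down w)
    show ?thesis
      using that unfolding Down tour_to_Down
      by (elim disjE exE conjE) (metis eq option.inject leD)+
  next
    case (Up u)
    show ?thesis
      using that unfolding Up tour_to_Up by (elim disjE exE conjE) (use eq in \<open>simp; blast\<close>)+
  qed
  then show ?thesis by (auto simp: single_valued_def)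
qed

section \<open>Reachability along the Euler tour\<close>

lemma tour_Up_parent:
  assumes fin: "finite (dom p)"
  shows "p v = Some u \<Longrightarrow>
    (\<And>w. p w = Some u \<Longrightarrow> key v < key w \<Longrightarrow> (Down w, Up w) \<in> (tour key p U)\<^sup>*) \<Longrightarrow>
    (Up v, Up u) \<in> (tour key p U)\<^sup>*"
proof (induction "card {w. p w = Some u \<and> key v < key w}" arbitrary: v rule: less_induct)
  case less
  let ?W = "\<lambda>v. {w. p w = Some u \<and> key v < key w}"
  have "finite (?W v)" by (rule finite_subset[OF _ fin]) auto
  show ?case
  proof (cases "?W v = {}")
    case True
    then have "(Up v, Up u) \<in> tour key p U" using less.prems(1) by (intro tour.last) force+
    then show ?thesis by blast
  next
    case False
    \<comment> \<open>This is the next sibling after \<open>v\<close>. The tour goes down to it,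
      around its subtree and up again, after which fewer later siblings remain.\<close>
    define w where "w = arg_min_on key (?W v)"
    have w: "p w = Some u" "key v < key w" "\<And>z. p z = Some u \<Longrightarrow> key v < key z \<Longrightarrow> key w \<le> key z"
      using arg_min_if_finite[OF \<open>finite (?W v)\<close> False, of key]
      by (auto simp: w_def[symmetric] not_less)
    then have "(Up v, Down w) \<in> tour key p U"
      using less.prems(1) by (intro tour.sibling[of _ v u]) force+
    moreover have "(Down w, Up w) \<in> (tour key p U)\<^sup>*" using less.prems(2) w by blast
    moreover have "(Up w, Up u) \<in> (tour key p U)\<^sup>*"
    proof (rule less.hyps)
      have "?W w \<subset> ?W v" using w by force
      then show "card (?W w) < card (?W v)" using \<open>finite (?W v)\<close> by (rule psubset_card_mono[rotated])
    qed (use w less.prems(2) in force)+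
    ultimately show ?thesis by (meson converse_rtrancl_into_rtrancl rtrancl_trans)
  qed
qed

text \<open>Levels grow towards the root, so induction on the level assumes the claim for the
  children. A leaf is turned at directly; otherwise the tour enters the first child and works
  through its siblings.\<close>

lemma tour_Down_Up:
  assumes fin: "finite (dom p)" and lev: "\<And>v u. p v = Some u \<Longrightarrow> v \<in> U \<and> lev u = Suc (lev v)"
  shows "u \<in> U \<Longrightarrow> (Down u, Up u) \<in> (tour key p U)\<^sup>*"
proof (induction "lev u" arbitrary: u rule: less_induct)
  case less
  let ?W = "{w. p w = Some u}"
  have fW: "finite ?W" by (rule finite_subset[OF _ fin]) auto
  show ?case
  proof (cases "?W = {}")
    case True
    then show ?thesis using less.prems by (intro r_into_rtrancl tour.leaf) auto
  next
    case False
    define v where "v = arg_min_on key ?W"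
    have v: "p v = Some u" "\<And>w. p w = Some u \<Longrightarrow> key v \<le> key w"
      using arg_min_if_finite[OF fW False, of key] by (auto simp: v_def[symmetric] not_less)
    have IH: "(Down w, Up w) \<in> (tour key p U)\<^sup>*" if "p w = Some u" for w
      using less.hyps[of w] lev[OF that] by simp
    have "(Down u, Down v) \<in> tour key p U" using v by (rule tour.first)
    moreover have "(Up v, Up u) \<in> (tour key p U)\<^sup>*" using fin v(1) IH by (rule tour_Up_parent)
    ultimately show ?thesis using IH[OF v(1)] by (meson converse_rtrancl_into_rtrancl rtrancl_trans)
  qed
qed

text \<open>For each parent step the tour completes the subtrees of the later siblings and then
  moves up. Thus it follows the iteration of \<open>p\<close>, with detours.\<close>

lemma tour_Up_ancestor:
  assumes "finite (dom p)" and lev: "\<And>v u. p v = Some u \<Longrightarrow> v \<in> U \<and> lev u = Suc (lev v)"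
    and "(v, u) \<in> {(v, u). p v = Some u}\<^sup>*"
  shows "(Up v, Up u) \<in> (tour key p U)\<^sup>*"
  using assms(3)
proof (induction rule: rtrancl_induct)
  case (step y z)
  have "(Down w, Up w) \<in> (tour key p U)\<^sup>*" if "p w = Some z" for w
    using tour_Down_Up[where p = p and lev = lev, OF assms(1) lev] lev[OF that] by blast
  then have "(Up y, Up z) \<in> (tour key p U)\<^sup>*"
    using step.hyps(2) by (intro tour_Up_parent[OF assms(1)]) auto
  with step.IH show ?case by (rule rtrancl_trans)
qed simp

text \<open>The orientation of the pipes: \<open>True\<close> means that water flows from Alice's
  side to Bob's. Alice holds the forest edges into even levels and out of them Bob does, so going up
  through an even node or down through an odd one leads from Alice to Bob.\<close>

fun upward :: "('v \<Rightarrow> nat) \<Rightarrow> 'v arc \<Rightarrow> bool" where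
  "upward lev (Down v) = odd (lev v)"
| "upward lev (Up v) = even (lev v)"

text \<open>Every arc concerns one node \<open>u\<close> and its children. The children have level
  parity \<open>b\<close> and \<open>u\<close> has the opposite one, so passing from child to
  parent, turning between siblings or turning at a leaf switches the orientation. Alice uses
  \<open>b = False\<close>, Bob \<open>b = True\<close>.\<close>

lemma tour_alternates:
  assumes "\<And>v u. p v = Some u \<Longrightarrow> v \<in> V \<and> u \<in> V \<and> lev u = Suc (lev v) \<and> even (lev v) = b"
    and "U \<subseteq> {v \<in> V. even (lev v) = (\<not> b)}"
  shows "tour key p U \<subseteq> {q \<in> Down ` V \<union> Up ` V. upward lev q = b} \<times>
    {q \<in> Down ` V \<union> Up ` V. upward lev q = (\<not> b)}"
proof (rule subrelI)
  fix q r assume "(q, r) \<in> tour key p U"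
  then show "(q, r) \<in> {q \<in> Down ` V \<union> Up ` V. upward lev q = b} \<times>
    {q \<in> Down ` V \<union> Up ` V. upward lev q = (\<not> b)}"
  proof cases
    case (first v u)
    then show ?thesis using assms(1)[of v u] by auto
  next
    case (leaf u)
    then show ?thesis using assms(2) by auto
  next
    case (sibling v u w)
    then show ?thesis using assms(1)[of v u] assms(1)[of w u] by auto
  next
    case (last v u)
    then show ?thesis using assms(1)[of v u] by auto
  qed
qed

text \<open>
  Alice knows the edges from odd to even levels and Bob those from even to odd levels, so that
  the children of any given node are known to a single player.
\<close>

lemma GH_le_forest:
  fixes V :: "'v set"
  assumes V: "finite V" "v0 \<in> V" "even (lev v0)"
    and pA: "\<And>x v u. length x = n \<Longrightarrow> pA x v = Some u \<Longrightarrow>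
      v \<in> V \<and> u \<in> V \<and> lev u = Suc (lev v) \<and> odd (lev v)"
    and pB: "\<And>y v u. length y = n \<Longrightarrow> pB y v = Some u \<Longrightarrow>
      v \<in> V \<and> u \<in> V \<and> lev u = Suc (lev v) \<and> even (lev v)"
    and root: "\<And>x y. length x = n \<Longrightarrow> length y = n \<Longrightarrow>
      \<exists>u. (v0, u) \<in> {(v, u). pA x v = Some u \<or> pB y v = Some u}\<^sup>* \<and>
        pA x u = None \<and> pB y u = None \<and> even (lev u) = h x y"
  shows "GH n h \<le> 2 * card V"
proof -
  obtain key :: "'v \<Rightarrow> nat" where key: "inj_on key V"
    using finite_imp_inj_to_nat_seg[OF V(1)] by blast
  \<comment> \<open>Turns at childless nodes of even level go to Alice: possible children there have
    odd level, so she alone decides whether there are any.\<close>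
  define RA where "RA x = tour key (pA x) {v \<in> V. even (lev v)}" for x
  define RB where "RB y = tour key (pB y) {v \<in> V. odd (lev v)}" for y
  have domA: "dom (pA x) \<subseteq> V" if "length x = n" for x using pA[OF that] by auto
  have domB: "dom (pB y) \<subseteq> V" if "length y = n" for y using pB[OF that] by auto
  have "GH n h \<le> card (Down ` V \<union> Up ` V)"
  proof (rule GH_le_card)
    show "finite (Down ` V \<union> Up ` V)" "Up v0 \<in> Down ` V \<union> Up ` V" "upward lev (Up v0)"
      using V by auto
  next
    fix x :: "bool list" assume x: "length x = n"
    show "RA x \<subseteq> {q \<in> Down ` V \<union> Up ` V. \<not> upward lev q} \<times> {q \<in> Down ` V \<union> Up ` V. upward lev q}"
      using tour_alternates[of "pA x" V lev False "{v \<in> V. even (lev v)}" key] pA[OF x] by (simp add: RA_def)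
    have "inj_on key (dom (pA x))" using key domA[OF x] by (rule inj_on_subset)
    then show "single_valued (RA x)" "single_valued ((RA x)\<inverse>)"
      unfolding RA_def by (rule single_valued_tour, rule single_valued_converse_tour)
  next
    fix y :: "bool list" assume y: "length y = n"
    show "RB y \<subseteq> {q \<in> Down ` V \<union> Up ` V. upward lev q} \<times> {q \<in> Down ` V \<union> Up ` V. \<not> upward lev q}"
      using tour_alternates[of "pB y" V lev True "{v \<in> V. odd (lev v)}" key] pB[OF y] by (simp add: RB_def)
    have "inj_on key (dom (pB y))" using key domB[OF y] by (rule inj_on_subset)
    then show "single_valued (RB y)" "single_valued ((RB y)\<inverse>)"
      unfolding RB_def by (rule single_valued_tour, rule single_valued_converse_tour)
  next
    fix x y :: "bool list" assume x: "length x = n" and y: "length y = n"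
    define p where "p v = (if odd (lev v) then pA x v else pB y v)" for v
    have p_iff: "p v = Some u \<longleftrightarrow> pA x v = Some u \<or> pB y v = Some u" for v u
      using pA[OF x] pB[OF y] by (auto simp: p_def)
    have lev: "v \<in> V \<and> lev u = Suc (lev v)" if "p v = Some u" for v u
      using that pA[OF x] pB[OF y] by (auto simp: p_iff)
    \<comment> \<open>The parity of a node decides which player provides its children. Hence every
      arc of the tour of the joint forest belongs to the tour of one player.\<close>
    have children: "if even (lev u) then p v = Some u \<longleftrightarrow> pA x v = Some u
        else p v = Some u \<longleftrightarrow> pB y v = Some u" for v u
      using pA[OF x, of v u] pB[OF y, of v u] by (auto simp: p_iff)
    have sub: "tour key p V \<subseteq> RA x \<union> RB y"
    proof (rule subrelI)
      have A: "p v = Some u \<longleftrightarrow> pA x v = Some u" if "even (lev u)" for v u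
        using children[of u v] that by simp
      have B: "p v = Some u \<longleftrightarrow> pB y v = Some u" if "odd (lev u)" for v u
        using children[of u v] that by simp
      fix q r assume "(q, r) \<in> tour key p V"
      then show "(q, r) \<in> RA x \<union> RB y"
      proof cases
        case (first v u)
        then show ?thesis
          by (cases "even (lev u)") (auto simp: A B RA_def RB_def tour_from_Down)
      next
        case (leaf u)
        then show ?thesis
          by (cases "even (lev u)") (auto simp: A B RA_def RB_def tour_from_Down)
      next
        case (sibling v u w)
        then show ?thesis
          by (cases "even (lev u)") (auto simp: A B RA_def RB_def tour_from_Up)
      next
        case (last v u)
        then show ?thesis
          by (cases "even (lev u)") (auto simp: A B RA_def RB_def tour_from_Up)
      qed
    qed
    obtain u where u: "(v0, u) \<in> {(v, u). p v = Some u}\<^sup>*" "pA x u = None" "pB y u = None"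
      "even (lev u) = h x y"
      using root[OF x y] by (auto simp: p_iff)
    have "finite (dom p)" by (rule finite_subset[OF _ V(1)]) (use lev in auto)
    then have "(Up v0, Up u) \<in> (tour key p V)\<^sup>*" using lev u(1) by (rule tour_Up_ancestor)
    then have "(Up v0, Up u) \<in> (RA x \<union> RB y)\<^sup>*" using rtrancl_mono[OF sub] by blast
    \<comment> \<open>An arc out of \<open>Up u\<close> leads to a sibling or the parent of
      \<open>u\<close>, and the root has no parent.\<close>
    moreover have "Up u \<notin> Domain (RA x \<union> RB y)"
      using u(2,3) by (auto simp: RA_def RB_def tour_from_Up)
    ultimately show "\<exists>q. (Up v0, q) \<in> (RA x \<union> RB y)\<^sup>* \<and> q \<notin> Domain (RA x \<union> RB y) \<and> upward lev q = h x y"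
      using u(4) by (intro exI[of _ "Up u"]) simp
  qed
  also have "\<dots> \<le> card (Down ` V) + card (Up ` V)" by (rule card_Un_le)
  also have "\<dots> \<le> 2 * card V" using card_image_le[OF V(1), of Down] card_image_le[OF V(1), of Up] by simp
  finally show ?thesis .
qed

text \<open>
  A run that rejects is prolonged by one step, so that the parity of the root's level gives the output.
\<close>

lemma GH_le_layered:
  fixes C :: "'c set"
  assumes C: "finite C" "c0 \<in> C" and T: "even T"
    and run: "\<And>x y. length x = n \<Longrightarrow> length y = n \<Longrightarrow>
      \<exists>c. c 0 = c0 \<and> (\<forall>t\<le>T. c t \<in> C) \<and>
        (\<forall>t<T. c (Suc t) = (if even t then FB y (c t) else FA x (c t))) \<and> (acc (c T) \<longleftrightarrow> h x y)"
  shows "GH n h \<le> 2 * ((T + 2) * card C)"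
proof -
  \<comment> \<open>Layers \<open>0\<close> to \<open>T\<close> hold the run; layer
    \<open>T + 1\<close> receives the extra step after a rejection.\<close>
  define V where "V = {..Suc T} \<times> C"
  define pA where "pA x v = (case v of (t, c) \<Rightarrow>
    if odd t \<and> t < T \<and> c \<in> C \<and> FA x c \<in> C then Some (Suc t, FA x c) else None)" for x v
  \<comment> \<open>The extra step out of layer \<open>T\<close> falls to Bob because
    \<open>T\<close> is even. Neither player needs an input for it, since \<open>acc\<close> depends
    on the configuration only.\<close>
  define pB where "pB y v = (case v of (t, c) \<Rightarrow>
    if even t \<and> t < T \<and> c \<in> C \<and> FB y c \<in> C then Some (Suc t, FB y c)
    else if t = T \<and> c \<in> C \<and> \<not> acc c then Some (Suc T, c) else None)" for y v
  have "GH n h \<le> 2 * card V"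
  proof (rule GH_le_forest[where lev = fst and pA = pA and pB = pB])
    show "finite V" "(0, c0) \<in> V" "even (fst (0, c0))" using C by (auto simp: V_def)
  next
    fix x v u assume "pA x v = Some u"
    then show "v \<in> V \<and> u \<in> V \<and> fst u = Suc (fst v) \<and> odd (fst v)"
      by (auto simp: pA_def V_def split: prod.splits if_splits)
  next
    fix y v u assume "pB y v = Some u"
    then show "v \<in> V \<and> u \<in> V \<and> fst u = Suc (fst v) \<and> even (fst v)"
      using T by (auto simp: pB_def V_def split: prod.splits if_splits)
  next
    fix x y :: "bool list" assume "length x = n" "length y = n"
    then obtain c where c: "c 0 = c0" "\<And>t. t \<le> T \<Longrightarrow> c t \<in> C"
      "\<And>t. t < T \<Longrightarrow> c (Suc t) = (if even t then FB y (c t) else FA x (c t))" "acc (c T) \<longleftrightarrow> h x y"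
      using run by blast
    let ?R = "{(v, u). pA x v = Some u \<or> pB y v = Some u}"
    have "((0, c0), (t, c t)) \<in> ?R\<^sup>*" if "t \<le> T" for t
      using that
    proof (induction t)
      case (Suc t)
      then have "((t, c t), (Suc t, c (Suc t))) \<in> ?R"
        using c(2)[of t] c(2)[of "Suc t"] c(3)[of t]
        by (cases "even t") (simp_all add: pA_def pB_def)
      then show ?case using Suc by (simp add: rtrancl_into_rtrancl)
    qed (simp add: c(1))
    then have reach: "((0, c0), (T, c T)) \<in> ?R\<^sup>*" by simp
    show "\<exists>u. ((0, c0), u) \<in> ?R\<^sup>* \<and> pA x u = None \<and> pB y u = None \<and> even (fst u) = h x y"
    proof (cases "h x y")
      case True
      then show ?thesis using reach T c(4) by (intro exI[of _ "(T, c T)"]) (simp add: pA_def pB_def)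
    next
      case False
      then have "((T, c T), (Suc T, c T)) \<in> ?R" using T c(2)[of T] c(4) by (simp add: pB_def)
      with reach have "((0, c0), (Suc T, c T)) \<in> ?R\<^sup>*" by (rule rtrancl_into_rtrancl)
      then show ?thesis using False T by (intro exI[of _ "(Suc T, c T)"]) (simp add: pA_def pB_def)
    qed
  qed
  also have "card V = (T + 2) * card C" by (simp add: V_def card_cartesian_product)
  finally show ?thesis .
qed

section \<open>Configurations of space-bounded machines\<close>

text \<open>A discrete intermediate value argument: the walk hits all
  \<open>\<bar>f t\<bar> + 1\<close> integers between \<open>0\<close> and
  \<open>f t\<close>.\<close>

lemma abs_walk_less_card:
  fixes f :: "nat \<Rightarrow> int"
  assumes "f 0 = 0" "\<And>t. \<bar>f (Suc t) - f t\<bar> \<le> 1"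
  shows "\<bar>f t\<bar> < int (card (f ` {..t}))"
proof -
  have sub: "{min 0 (f t)..max 0 (f t)} \<subseteq> f ` {..t}"
  proof (induction t)
    case (Suc t)
    have "{min 0 (f (Suc t))..max 0 (f (Suc t))} \<subseteq> insert (f (Suc t)) {min 0 (f t)..max 0 (f t)}"
      using assms(2)[of t] by auto
    also have "\<dots> \<subseteq> f ` {..Suc t}" using Suc by (auto simp: atMost_Suc)
    finally show ?case .
  qed (simp add: assms(1))
  have "nat \<bar>f t\<bar> + 1 = card {min 0 (f t)..max 0 (f t)}" by simp
  also have "\<dots> \<le> card (f ` {..t})" using sub by (intro card_mono) auto
  finally show ?thesis by linarith
qed

text \<open>The blank part outside the window makes this set finite for a finite alphabet, although
  contents are functions on all integers.\<close>

definition work_tapes :: "tm \<Rightarrow> nat \<Rightarrow> work_tape set" where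
  "work_tapes M K = {(u, p). \<bar>p\<bar> \<le> int K \<and> range u \<subseteq> symbols M \<and> (\<forall>z. int K < \<bar>z\<bar> \<longrightarrow> u z = blank M)}"

definition configs :: "tm \<Rightarrow> nat \<Rightarrow> nat \<Rightarrow> config set" where
  "configs M h K = {C. state C \<in> states M \<and> input_head C \<le> h \<and>
     length (work C) = tapes M \<and> set (work C) \<subseteq> work_tapes M K}"

text \<open>A tape is determined by its contents on the \<open>2 * K + 1\<close> cells of the window
  and the head position in it.\<close>

lemma work_tapes_bound:
  assumes "finite (symbols M)"
  shows "finite (work_tapes M K)"
    and "card (work_tapes M K) \<le> card (symbols M) ^ (2 * K + 1) * (2 * K + 1)"
proof -
  let ?I = "{- int K..int K}"
  let ?F = "\<lambda>(g, p). ((\<lambda>z. if z \<in> ?I then g z else blank M, p) :: work_tape)"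
  let ?D = "(?I \<rightarrow>\<^sub>E symbols M) \<times> ?I"
  have fin: "finite ?D" using assms by (intro finite_cartesian_product finite_PiE) auto
  have sub: "work_tapes M K \<subseteq> ?F ` ?D"
  proof
    fix v assume "v \<in> work_tapes M K"
    then obtain u p where v: "v = (u, p)" "\<bar>p\<bar> \<le> int K" "range u \<subseteq> symbols M"
      "\<And>z. int K < \<bar>z\<bar> \<Longrightarrow> u z = blank M" by (auto simp: work_tapes_def)
    have "v = ?F (restrict u ?I, p)" using v(1,4) by (auto simp: fun_eq_iff)
    moreover have "(restrict u ?I, p) \<in> ?D" using v(2,3) by auto
    ultimately show "v \<in> ?F ` ?D" by blast
  qed
  then show "finite (work_tapes M K)" using fin by (rule finite_surj[rotated])
  have "card (work_tapes M K) \<le> card ?D" using fin sub by (rule surj_card_le)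
  also have "\<dots> = card (symbols M) ^ (2 * K + 1) * (2 * K + 1)"
    by (simp add: card_cartesian_product card_PiE nat_add_distrib nat_mult_distrib algebra_simps)
  finally show "card (work_tapes M K) \<le> card (symbols M) ^ (2 * K + 1) * (2 * K + 1)" .
qed

lemma configs_bound:
  assumes "turing_machine M"
  shows "finite (configs M h K)"
    and "card (configs M h K) \<le> card (states M) * (h + 1) *
      (card (symbols M) ^ (2 * K + 1) * (2 * K + 1)) ^ tapes M"
proof -
  have fin: "finite (states M)" "finite (symbols M)" using assms by (auto simp: turing_machine_def)
  note W = work_tapes_bound[OF fin(2), of K]
  let ?F = "\<lambda>(q, i, ts). \<lparr>state = q, input_head = i, work = ts\<rparr>"
  let ?L = "{ts. set ts \<subseteq> work_tapes M K \<and> length ts = tapes M}"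
  let ?D = "states M \<times> {..h} \<times> ?L"
  have finD: "finite ?D" using fin finite_lists_length_eq[OF W(1)] by auto
  have sub: "configs M h K \<subseteq> ?F ` ?D"
  proof
    fix C assume "C \<in> configs M h K"
    then have "C = ?F (state C, input_head C, work C)" "(state C, input_head C, work C) \<in> ?D"
      by (auto simp: configs_def)
    then show "C \<in> ?F ` ?D" by (rule image_eqI)
  qed
  then show "finite (configs M h K)" using finD by (rule finite_surj[rotated])
  have "card (configs M h K) \<le> card ?D" using finD sub by (rule surj_card_le)
  also have "\<dots> = card (states M) * (h + 1) * card (work_tapes M K) ^ tapes M"
    by (simp add: card_cartesian_product card_lists_length_eq[OF W(1)] algebra_simps)
  also have "\<dots> \<le> card (states M) * (h + 1) *
      (card (symbols M) ^ (2 * K + 1) * (2 * K + 1)) ^ tapes M"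
    using W(2) by (intro mult_le_mono2 power_mono) auto
  finally show "card (configs M h K) \<le> card (states M) * (h + 1) *
      (card (symbols M) ^ (2 * K + 1) * (2 * K + 1)) ^ tapes M" .
qed

section \<open>Runs in bounded space and their halting times\<close>

definition wf_config :: "tm \<Rightarrow> nat \<Rightarrow> config \<Rightarrow> bool" where
  "wf_config M h C \<longleftrightarrow> state C \<in> states M \<and> input_head C \<le> h \<and> length (work C) = tapes M \<and>
     (\<forall>v \<in> set (work C). range (fst v) \<subseteq> symbols M)"

lemma delta_closed:
  assumes M: "turing_machine M" and q: "q \<in> states M - halting M"
    and bs: "set bs \<subseteq> symbols M" "length bs = tapes M" and D: "delta M q a bs = (q', d, acts)"
  shows "q' \<in> states M" "length acts = tapes M" "(b, e) \<in> set acts \<Longrightarrow> b \<in> symbols M"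
proof -
  have "\<forall>q \<in> states M - halting M. \<forall>a bs. set bs \<subseteq> symbols M \<and> length bs = tapes M \<longrightarrow>
        (case delta M q a bs of (q', d, acts) \<Rightarrow>
           q' \<in> states M \<and> length acts = tapes M \<and> (\<forall>(b, e) \<in> set acts. b \<in> symbols M))"
    using M unfolding turing_machine_def by (elim conjE)
  from spec[OF spec[OF bspec[OF this q]], of bs a]
  have "q' \<in> states M \<and> length acts = tapes M \<and> (\<forall>(b, e) \<in> set acts. b \<in> symbols M)"
    using bs D by simp
  then show "q' \<in> states M" "length acts = tapes M" "(b, e) \<in> set acts \<Longrightarrow> b \<in> symbols M" by auto
qed

lemma step_wf_config:
  assumes M: "turing_machine M" and C: "wf_config M (length w + 1) C"
  shows "wf_config M (length w + 1) (step M w C)"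
    and "j < tapes M \<Longrightarrow> \<bar>snd (work (step M w C) ! j) - snd (work C ! j)\<bar> \<le> 1"
    and "j < tapes M \<Longrightarrow> z \<noteq> snd (work C ! j) \<Longrightarrow> fst (work (step M w C) ! j) z = fst (work C ! j) z"
proof -
  let ?bs = "map (\<lambda>(u, p). u p) (work C)"
  obtain q d acts where D: "delta M (state C) (read_input w (input_head C)) ?bs = (q, d, acts)"
    by (metis prod_cases3)
  have "wf_config M (length w + 1) (step M w C) \<and> (\<forall>j < tapes M.
      \<bar>snd (work (step M w C) ! j) - snd (work C ! j)\<bar> \<le> 1 \<and>
      (\<forall>z. z \<noteq> snd (work C ! j) \<longrightarrow> fst (work (step M w C) ! j) z = fst (work C ! j) z))"
  proof (cases "state C \<in> halting M")
    case True
    then show ?thesis using C by (simp add: step_def)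
  next
    case False
    have len: "length (work C) = tapes M" using C by (simp add: wf_config_def)
    have bs: "set ?bs \<subseteq> symbols M" "length ?bs = tapes M"
      using C by (fastforce simp: wf_config_def)+
    have "state C \<in> states M - halting M" using C False by (simp add: wf_config_def)
    note q = delta_closed(1)[OF M this bs D] and la = delta_closed(2)[OF M this bs D]
      and sy = delta_closed(3)[OF M this bs D]
    have S: "step M w C = \<lparr>state = q, input_head = move_input w d (input_head C),
        work = map2 act acts (work C)\<rparr>"
      using False D by (simp add: step_def)
    have nth: "map2 act acts (work C) ! j = act (acts ! j) (work C ! j)" if "j < tapes M" for j
      using that len la by simp
    have "move_input w d (input_head C) \<le> length w + 1"
      using C by (cases d) (auto simp: wf_config_def)
    moreover have "range (fst v) \<subseteq> symbols M" if v: "v \<in> set (map2 act acts (work C))" for v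
    proof -
      obtain j where j: "j < tapes M" "v = act (acts ! j) (work C ! j)"
        using v len la by (metis in_set_conv_nth nth length_map length_zip min.idem)
      have "range (fst (work C ! j)) \<subseteq> symbols M"
        using C j(1) by (auto simp: wf_config_def)
      moreover have "fst (acts ! j) \<in> symbols M"
        using sy[of "fst (acts ! j)" "snd (acts ! j)"] j(1) la by simp
      ultimately show ?thesis
        by (cases "acts ! j"; cases "work C ! j") (auto simp: j(2))
    qed
    ultimately have "wf_config M (length w + 1) (step M w C)"
      using q len la by (auto simp: wf_config_def S)
    moreover have "\<bar>snd (work (step M w C) ! j) - snd (work C ! j)\<bar> \<le> 1 \<and>
      (\<forall>z. z \<noteq> snd (work C ! j) \<longrightarrow> fst (work (step M w C) ! j) z = fst (work C ! j) z)"
      if "j < tapes M" for j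
    proof -
      obtain b e u p where "acts ! j = (b, e)" "work C ! j = (u, p)" by fastforce
      then show ?thesis using nth[OF that] by (cases e) (simp_all add: S)
    qed
    ultimately show ?thesis by blast
  qed
  then show "wf_config M (length w + 1) (step M w C)"
    "j < tapes M \<Longrightarrow> \<bar>snd (work (step M w C) ! j) - snd (work C ! j)\<bar> \<le> 1"
    "j < tapes M \<Longrightarrow> z \<noteq> snd (work C ! j) \<Longrightarrow> fst (work (step M w C) ! j) z = fst (work C ! j) z"
    by blast+
qed

lemma run_0: "run M w 0 = init_config M"
  and run_Suc: "run M w (Suc t) = step M w (run M w t)"
  by (simp_all add: run_def)

lemma run_add: "run M w (s + t) = (step M w ^^ s) (run M w t)"
  by (simp add: run_def funpow_add)

lemma run_halted:
  assumes "state (run M w T) \<in> halting M" "T \<le> t"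
  shows "run M w t = run M w T"
  using assms(2)
proof (induction t rule: dec_induct)
  case (step t)
  then show ?case using assms(1) by (simp add: run_Suc step_def)
qed simp

lemma run_wf_config:
  assumes "turing_machine M"
  shows "wf_config M (length w + 1) (run M w t)"
proof (induction t)
  case 0
  then show ?case using assms
    by (auto simp: run_0 init_config_def wf_config_def turing_machine_def)
next
  case (Suc t)
  then show ?case using step_wf_config(1)[OF assms] by (simp add: run_Suc)
qed

text \<open>Each head walks from \<open>0\<close> in steps of at most one cell, so visiting at most
  \<open>K\<close> cells keeps it within distance \<open>K\<close>. Only scanned cells change, hence
  all cells farther away stay blank. After halting nothing changes.\<close>

lemma run_in_configs:
  assumes M: "turing_machine M" and T: "state (run M w T) \<in> halting M"
    and K: "card (visited_cells M w T) \<le> K"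
  shows "run M w t \<in> configs M (length w + 1) K"
proof -
  have wf: "wf_config M (length w + 1) (run M w t)" for t using M by (rule run_wf_config)
  have head: "\<bar>snd (work (run M w t) ! j)\<bar> < int K" if "t \<le> T" "j < tapes M" for t j
  proof -
    let ?f = "\<lambda>t. snd (work (run M w t) ! j)"
    have "\<bar>?f t\<bar> < int (card (?f ` {..t}))"
    proof (rule abs_walk_less_card)
      show "?f 0 = 0" using that by (simp add: run_0 init_config_def)
      show "\<bar>?f (Suc t) - ?f t\<bar> \<le> 1" for t
        using step_wf_config(2)[OF M wf that(2)] by (simp add: run_Suc)
    qed
    \<comment> \<open>Labelling the positions with the tape number embeds them into
      \<open>visited_cells\<close>, which counts the cells of all tapes together.\<close>
    also have "card (?f ` {..t}) = card (Pair j ` ?f ` {..t})"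
      by (intro card_image[symmetric] inj_onI) simp
    also have "\<dots> \<le> card (visited_cells M w T)"
      using that by (intro card_mono) (auto simp: visited_cells_def)
    finally show ?thesis using K by simp
  qed
  have outside: "fst (work (run M w t) ! j) z = blank M" if "t \<le> T" "j < tapes M" "int K < \<bar>z\<bar>" for t j z
    using that(1)
  proof (induction t)
    case 0
    then show ?case using that by (simp add: run_0 init_config_def)
  next
    case (Suc t)
    then have "z \<noteq> snd (work (run M w t) ! j)" using head[of t j] that by auto
    then show ?case using Suc step_wf_config(3)[OF M wf that(2)] by (simp add: run_Suc)
  qed
  have conf: "run M w t \<in> configs M (length w + 1) K" if t: "t \<le> T" for t
  proof -
    have "v \<in> work_tapes M K" if "v \<in> set (work (run M w t))" for v
    proof -
      obtain j where j: "v = work (run M w t) ! j" "j < tapes M"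
        using \<open>v \<in> set _\<close> wf[of t] unfolding in_set_conv_nth wf_config_def by auto
      then show ?thesis
        using head[OF t j(2)] outside[OF t j(2)] wf[of t] that
        by (auto simp: work_tapes_def wf_config_def case_prod_beta)
    qed
    then show ?thesis using wf[of t] by (auto simp: configs_def wf_config_def)
  qed
  show ?thesis
  proof (cases "t \<le> T")
    case False
    then show ?thesis using run_halted[OF T, of t] conf[of T] by simp
  qed (rule conf)
qed

text \<open>No configuration repeats up to the first halting time \<open>H\<close>, so there are
  \<open>H + 1\<close> distinct ones in \<open>C\<close> and \<open>H < card C\<close>.\<close>

lemma run_after_card:
  assumes "state (run M w T) \<in> halting M" "finite C" "\<And>t. run M w t \<in> C" "card C \<le> t"
  shows "run M w t = run M w T"
proof -
  define H where "H = (LEAST T. state (run M w T) \<in> halting M)"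
  have H: "state (run M w H) \<in> halting M" unfolding H_def using assms(1) by (rule LeastI)
  have least: "\<not> state (run M w s) \<in> halting M" if "s < H" for s
    using that unfolding H_def by (rule not_less_Least)
  have "run M w i \<noteq> run M w j" if "i < j" "j \<le> H" for i j
  proof
    assume "run M w i = run M w j"
    \<comment> \<open>Equal configurations have equal futures, so the halt at time \<open>H\<close>
      would already occur \<open>j - i\<close> steps earlier.\<close>
    then have "run M w (H - j + i) = run M w (H - j + j)" by (simp only: run_add)
    then have "state (run M w (H - j + i)) \<in> halting M" using that(2) H by simp
    then show False using that least[of "H - j + i"] by linarith
  qed
  then have "inj_on (run M w) {..H}"
    by (intro linorder_inj_onI) auto
  then have "card {..H} \<le> card C" using assms(2,3) by (intro card_inj_on_le) auto
  then have "H \<le> t" using assms(4) by simp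
  then show ?thesis
    using run_halted[OF H, of t] run_halted[OF H, of "max H T"] run_halted[OF assms(1), of "max H T"] by simp
qed

section \<open>Simulation by half steps of the two players\<close>

lemma step_cong:
  assumes "read_input w (input_head C) = read_input w' (input_head C)" "length w = length w'"
  shows "step M w C = step M w' C"
proof -
  have "move_input w d i = move_input w' d i" for d i using assms(2) by (cases d) auto
  then show ?thesis using assms(1) by (simp add: step_def)
qed

text \<open>Two consecutive layers, one of Bob and one of Alice, advance the machine by at least one
  step. As the run halts within \<open>m\<close> steps, \<open>2 * m\<close> layers suffice.\<close>

lemma GH_le_configs:
  assumes M: "turing_machine M"
    and out: "\<And>x y. length x = n \<Longrightarrow> length y = n \<Longrightarrow> outputs_in_space M (x @ y) (h x y) (real K)"
  defines "m \<equiv> card (configs M (2 * n + 1) K)"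
  shows "GH n h \<le> 2 * ((2 * m + 2) * m)"
proof -
  define C where "C = configs M (2 * n + 1) K"
  have fin: "finite C" unfolding C_def by (rule configs_bound[OF M])
  have conf: "run M (x @ y) t \<in> C" if xy: "length x = n" "length y = n" for x y t
  proof -
    obtain T where "state (run M (x @ y) T) \<in> halting M" "card (visited_cells M (x @ y) T) \<le> K"
      using out[OF xy] by (auto simp: outputs_in_space_def)
    then show ?thesis using run_in_configs[OF M, of "x @ y" T K t] xy by (simp add: C_def mult_2)
  qed
  \<comment> \<open>The other player's input is replaced by zeros, which the half step never reads.\<close>
  define FA where "FA x c = (if input_head c \<le> n then step M (x @ replicate n False) c else c)" for x c
  define FB where "FB y c = (if input_head c \<le> n then c else step M (replicate n False @ y) c)" for y c
  \<comment> \<open>A step depends on the input only through the scanned symbol and the length.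
    Alice owns head positions \<open>0\<close> to \<open>n\<close>, including the left marker; Bob
    owns the rest, including the right marker.\<close>
  have FA: "FA x c = (if input_head c \<le> n then step M (x @ y) c else c)"
    if "length x = n" "length y = n" for x y c
    unfolding FA_def using that by (auto intro!: step_cong simp: read_input_def nth_append)
  have FB: "FB y c = (if input_head c \<le> n then c else step M (x @ y) c)"
    if "length x = n" "length y = n" for x y c
    unfolding FB_def using that by (auto intro!: step_cong simp: read_input_def nth_append)
  have "GH n h \<le> 2 * ((2 * m + 2) * card C)"
  proof (rule GH_le_layered[where FA = FA and FB = FB and acc = "\<lambda>c. output_bit M (state c)"])
    show "init_config M \<in> C"
      using conf[of "replicate n False" "replicate n False" 0] by (simp add: run_0)
  next
    fix x y :: "bool list" assume xy: "length x = n" "length y = n"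
    define w where "w = x @ y"
    obtain T where T: "state (run M w T) \<in> halting M" "output_bit M (state (run M w T)) = h x y"
      using out[OF xy] by (auto simp: outputs_in_space_def w_def)
    define c where "c = rec_nat (init_config M) (\<lambda>t c. if even t then FB y c else FA x c)"
    have c: "c 0 = init_config M" "c (Suc t) = (if even t then FB y (c t) else FA x (c t))" for t
      by (simp_all add: c_def)
    have F: "FA x (run M w j) = (if input_head (run M w j) \<le> n then run M w (Suc j) else run M w j)"
      "FB y (run M w j) = (if input_head (run M w j) \<le> n then run M w j else run M w (Suc j))" for j
      using FA[OF xy] FB[OF xy] by (simp_all add: run_Suc w_def)
    have c_run: "c t \<in> range (run M w)" for t
    proof (induction t)
      case 0
      show ?case unfolding c(1) run_0[symmetric, of M w] by blast
    next
      case (Suc t)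
      then show ?case by (auto simp: c(2) F)
    qed
    \<comment> \<open>If the head is on Alice's part, Bob waits and she steps. Otherwise Bob steps,
      and Alice adds a second step if the head has moved to her part. So the pair makes one or two
      steps.\<close>
    have progress: "\<exists>j\<ge>t. c (2 * t) = run M w j" for t
    proof (induction t)
      case 0
      show ?case by (intro exI[of _ 0]) (simp add: c(1) run_0)
    next
      case (Suc t)
      then obtain j where j: "t \<le> j" "c (2 * t) = run M w j" by blast
      have e: "c (2 * Suc t) = FA x (FB y (c (2 * t)))" by (simp add: c(2))
      have "c (2 * Suc t) \<in> {run M w (Suc j), run M w (Suc (Suc j))}"
        unfolding e j(2) by (simp add: F)
      then show ?case using j(1) by (auto intro: le_SucI)
    qed
    obtain j where j: "m \<le> j" "c (2 * m) = run M w j" using progress by blast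
    have "run M w j = run M w T"
      using T(1) fin conf[OF xy] j(1) unfolding w_def m_def C_def by (rule run_after_card)
    then have "output_bit M (state (c (2 * m))) = h x y" using T(2) j(2) by simp
    moreover have "c t \<in> C" for t using c_run[of t] conf[OF xy] by (auto simp: w_def)
    ultimately show "\<exists>c. c 0 = init_config M \<and> (\<forall>t\<le>2 * m. c t \<in> C) \<and>
        (\<forall>t<2 * m. c (Suc t) = (if even t then FB y (c t) else FA x (c t))) \<and>
        output_bit M (state (c (2 * m))) = h x y"
      using c by (intro exI[of _ c]) simp
  qed (use fin in auto)
  then show ?thesis by (simp add: m_def C_def)
qed

section \<open>Polynomial bound on the number of configurations\<close>

theorem theorem4p6:
  fixes f :: "nat \<Rightarrow> bool list \<Rightarrow> bool list \<Rightarrow> bool"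
  assumes "logspace_computable f"
  shows "\<exists>p :: real poly. \<forall>n\<ge>1. real (GH n (f n)) \<le> poly p (real n)"
proof -
  obtain M c where M: "turing_machine M"
    and out: "\<And>n x y. n \<ge> 1 \<Longrightarrow> length x = n \<Longrightarrow> length y = n \<Longrightarrow>
      outputs_in_space M (x @ y) (f n x y) (c * log 2 (real (2 * n)))"
    using assms unfolding logspace_computable_def by blast
  \<comment> \<open>A natural number that dominates \<open>c\<close>, which may be fractional or
    negative, so that the estimate gets an integer exponent.\<close>
  define a where "a = nat \<lceil>\<bar>c\<bar>\<rceil>"
  define g where "g = card (symbols M)"
  \<comment> \<open>This bounds the number of configurations: \<open>4 * n\<close> covers the
    \<open>2 * n + 2\<close> head positions as \<open>n \<ge> 1\<close>, and the last factor bounds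
    the tape contents with head positions. The exponents depend on \<open>M\<close> and
    \<open>c\<close> only.\<close>
  define B :: "nat \<Rightarrow> nat" where
    "B n = card (states M) * (4 * n) * ((2 * (2 * n) ^ (2 * a)) ^ (g + 1)) ^ tapes M" for n
  define q :: "real poly" where
    "q = [:real (card (states M)):] * [:0, 4:] * (([:2:] * [:0, 2:] ^ (2 * a)) ^ (g + 1)) ^ tapes M"
  have q: "poly q (real n) = real (B n)" for n
    by (simp add: q_def B_def poly_mult poly_power mult_ac)
  have "GH n (f n) \<le> 2 * ((2 * B n + 2) * B n)" if n: "n \<ge> 1" for n
  proof -
    \<comment> \<open>The number of visited cells is an integer, so its real bound may be rounded
      down.\<close>
    define K where "K = nat \<lfloor>c * log 2 (real (2 * n))\<rfloor>"
    have space: "outputs_in_space M (x @ y) (f n x y) (real K)" if xy: "length x = n" "length y = n" for x y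
    proof -
      obtain T where "state (run M (x @ y) T) \<in> halting M" "output_bit M (state (run M (x @ y) T)) = f n x y"
        "real (card (visited_cells M (x @ y) T)) \<le> c * log 2 (real (2 * n))"
        using out[OF n xy] by (auto simp: outputs_in_space_def)
      moreover from this(3) have "card (visited_cells M (x @ y) T) \<le> K"
        unfolding K_def by (rule le_nat_floor)
      ultimately show ?thesis unfolding outputs_in_space_def by auto
    qed
    have log: "log 2 (real (2 * n)) \<ge> 0" using n by simp
    have "c \<le> real a" unfolding a_def by linarith
    then have "c * log 2 (real (2 * n)) \<le> real a * log 2 (real (2 * n))"
      using log by (rule mult_right_mono)
    moreover have "real a * log 2 (real (2 * n)) \<ge> 0" using log by simp
    ultimately have "real K \<le> real a * log 2 (real (2 * n))"
      unfolding K_def by linarith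
    then have "2 powr real K \<le> 2 powr (log 2 (real (2 * n)) * real a)"
      by (simp add: mult.commute)
    also have "\<dots> = real (2 * n) ^ a" using n by (simp add: powr_powr[symmetric] powr_realpow)
    finally have "real (2 ^ K) \<le> real ((2 * n) ^ a)" by (simp add: powr_realpow)
    \<comment> \<open>Logarithmic space turns the exponential in \<open>K\<close> into a power of
      the input length.\<close>
    then have K: "2 ^ K \<le> (2 * n) ^ a" by (simp only: of_nat_le_iff)
    \<comment> \<open>These crude bounds express the number of tape contents and the number of head
      positions as powers of two, which combine into a power of
      \<open>2 ^ (2 * K + 1)\<close>.\<close>
    have exp: "2 * K + 1 \<le> 2 ^ (2 * K + 1)" "g \<le> 2 ^ g" using less_exp less_imp_le by blast+
    have pow: "((2::nat) ^ g) ^ j * 2 ^ j = (2 ^ j) ^ (g + 1)" for j :: nat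
      by (simp add: mult.commute flip: power_mult)
    have "g ^ (2 * K + 1) * (2 * K + 1) \<le> (2 ^ g) ^ (2 * K + 1) * 2 ^ (2 * K + 1)"
      using exp by (intro mult_le_mono power_mono) auto
    also have "\<dots> = (2 ^ (2 * K + 1)) ^ (g + 1)" by (rule pow)
    also have "(2::nat) ^ (2 * K + 1) = 2 * (2 ^ K) ^ 2" by (simp add: power_even_eq)
    also have "(2 * (2 ^ K) ^ 2) ^ (g + 1) \<le> (2 * ((2 * n) ^ a) ^ 2) ^ (g + 1)"
      using K by (intro power_mono mult_le_mono2) auto
    also have "((2 * n) ^ a) ^ 2 = (2 * n) ^ (2 * a)" by (simp only: power_even_eq)
    finally have "card (configs M (2 * n + 1) K) \<le> B n"
      unfolding B_def using n
      by (intro order_trans[OF configs_bound(2)[OF M]] mult_le_mono power_mono) (auto simp: g_def)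
    then show ?thesis
      by (intro order_trans[OF GH_le_configs[OF M space]] mult_le_mono) auto
  qed
  then have "real (GH n (f n)) \<le> real (2 * ((2 * B n + 2) * B n))" if "n \<ge> 1" for n
    using that by (simp only: of_nat_le_iff)
  also have "real (2 * ((2 * B n + 2) * B n)) = poly ([:2:] * (([:2:] * q + [:2:]) * q)) (real n)" for n
    by (simp add: q algebra_simps)
  finally show ?thesis by (intro exI[of _ "[:2:] * (([:2:] * q + [:2:]) * q)"]) simp
qed

end
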